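(* Let $n\geq 3$ and $\ell\geq 2$ be integers. Then $$pc_{1,\ell}(W_n)=\begin{cases} 1 & \text{if } n=3,\\ 2 & \text{if } 4\leq n\leq 6,\\ 3 & \text{otherwise.}\end{cases}$$
   Context: The wheel $W_n$ is the graph on $n+1$ vertices obtained from the cycle $C_n$ by joining a new vertex to all vertices of $C_n$. An edge-coloring of a graph is an arbitrary map from its edge set to the natural numbers (adjacent edges may share a color). In an edge-colored graph, a path $P$ is a distance $\ell$-proper path if no two edges of $P$ of the same color appear with fewer than $\ell$ edges in between on $P$. For a connected graph $G$, $pc_{1,\ell}(G)$ is the minimum number of colors in an edge-coloring of $G$ such that every pair of distinct vertices of $G$ is connected by at least one distance $\ell$-proper path. *)

theory Defs
  imports Main
begin

text \<open>
  A simple graph is a pair of a vertex set and a set of two-element subsets of it (the edges).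
\<close>

type_synonym 'a graph = "'a set \<times> 'a set set"

abbreviation verts :: "'a graph \<Rightarrow> 'a set" where
  "verts G \<equiv> fst G"

abbreviation edges :: "'a graph \<Rightarrow> 'a set set" where
  "edges G \<equiv> snd G"

text \<open>This is the cycle only for \<open>n \<ge> 3\<close>; for smaller \<open>n\<close> it degenerates.\<close>

definition cycle_graph :: "nat \<Rightarrow> nat graph" where
  "cycle_graph n = ({..<n}, {{i, Suc i mod n} | i. i < n})"

text \<open>The option type supplies the new vertex \<^term>\<open>None\<close>; old vertices are tagged by \<^term>\<open>Some\<close>.\<close>

definition join_vertex :: "'a graph \<Rightarrow> 'a option graph" where
  "join_vertex G =
     (insert None (Some ` verts G),
      (\<lambda>e. Some ` e) ` edges G \<union> {{None, Some v} | v. v \<in> verts G})"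

definition wheel :: "nat \<Rightarrow> nat option graph" where
  "wheel n = join_vertex (cycle_graph n)"

definition path_between :: "'a graph \<Rightarrow> 'a \<Rightarrow> 'a list \<Rightarrow> 'a \<Rightarrow> bool" where
  "path_between G u p v \<longleftrightarrow>
     p \<noteq> [] \<and> hd p = u \<and> last p = v \<and> distinct p \<and> set p \<subseteq> verts G \<and>
     successively (\<lambda>x y. {x, y} \<in> edges G) p"

definition path_edges :: "'a list \<Rightarrow> 'a set list" where
  "path_edges p = map2 (\<lambda>x y. {x, y}) p (tl p)"

text \<open>
  For positions \<open>i < j\<close> on the path there are exactly \<open>j - i - 1\<close> edges strictly in between.
\<close>

definition distance_proper :: "nat \<Rightarrow> ('a set \<Rightarrow> nat) \<Rightarrow> 'a list \<Rightarrow> bool" where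
  "distance_proper l c p \<longleftrightarrow>
     (let es = path_edges p in
      \<not> (\<exists>i j. i < j \<and> j < length es \<and> c (es ! i) = c (es ! j) \<and> j - i - 1 < l))"

definition proper_connected :: "nat \<Rightarrow> 'a graph \<Rightarrow> ('a set \<Rightarrow> nat) \<Rightarrow> bool" where
  "proper_connected l G c \<longleftrightarrow>
     (\<forall>u \<in> verts G. \<forall>v \<in> verts G. u \<noteq> v \<longrightarrow>
        (\<exists>p. path_between G u p v \<and> distance_proper l c p))"

text \<open>
  An edge-coloring is a total function on sets of vertices of which only the values on edges
  matter. The conjunct \<open>finite (c ` edges G)\<close> rules out \<^term>\<open>card\<close> being \<open>0\<close> on
  an infinite set of colors; it is automatic for finite graphs. For a finite connected graph an
  injective coloring shows that the \<open>LEAST\<close> below is attained; for a disconnected graph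
  the value is meaningless.
\<close>

definition pc1 :: "nat \<Rightarrow> 'a graph \<Rightarrow> nat" where
  "pc1 l G =
     (LEAST k. \<exists>c. proper_connected l G c \<and> finite (c ` edges G) \<and> card (c ` edges G) = k)"

end

theory Submission
  imports Defs
begin

text \<open>
  For \<open>l \<ge> 2\<close> any three consecutive edges of a distance \<open>l\<close>-proper path have
  distinct colors, so with at most two colors every such path has at most two edges. Two rim
  vertices at cyclic distance at least 3 can then only be joined through the hub, so their spokes
  have different colors; for \<open>n \<ge> 7\<close> the relation of being at distance at least 3
  contains an odd cycle, which is incompatible with two colors.

  Conversely, coloring the spokes alternately 0 and 1 and the rim with 2 always works:
  two rim vertices with equally colored spokes are joined by first moving along the rim to a neighbor
  with the other spoke color and then passing through the hub.
\<close>

section \<open>Distance-proper paths with few edges\<close>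

lemma distance_proper_edge: "distance_proper l c [u, v]"
  by (simp add: distance_proper_def path_edges_def)

lemma distance_proper_two_edges:
  assumes "c {u, w} \<noteq> c {w, v}"
  shows "distance_proper l c [u, w, v]"
  using assms by (auto simp: distance_proper_def path_edges_def less_Suc_eq)

lemma distance_proper_three_edges:
  assumes "c {u, w} \<noteq> c {w, x}" "c {u, w} \<noteq> c {x, v}" "c {w, x} \<noteq> c {x, v}"
  shows "distance_proper l c [u, w, x, v]"
  using assms by (auto simp: distance_proper_def path_edges_def less_Suc_eq Let_def)

text \<open>The bound \<open>j \<le> i + l\<close> says that fewer than \<open>l\<close> edges lie
  strictly between edges \<open>i\<close> and \<open>j\<close>, and \<open>Suc j < length p\<close>
  that edge \<open>j\<close> exists.\<close>

lemma distance_proper_nth_neq: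
  assumes "distance_proper l c p" "i < j" "j \<le> i + l" "Suc j < length p"
  shows "c {p ! i, p ! Suc i} \<noteq> c {p ! j, p ! Suc j}"
proof -
  have "path_edges p ! k = {p ! k, p ! Suc k}" "k < length (path_edges p)" if "Suc k < length p" for k
    using that by (auto simp: path_edges_def nth_tl)
  moreover from assms have "j - i - 1 < l" "Suc i < length p"
    by linarith+
  ultimately show ?thesis
    using assms unfolding distance_proper_def Let_def by metis
qed

lemma distance_proper_first_two:
  assumes "distance_proper l c (u # w # v # p)" "l \<ge> 1"
  shows "c {u, w} \<noteq> c {w, v}"
  using distance_proper_nth_neq[OF assms(1), of 0 1] assms(2) by simp

text \<open>One edge separates the first edge from the third, so \<open>l \<ge> 2\<close> makes even
  these two differ.\<close>

lemma distance_proper_first_three: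
  assumes "distance_proper l c (u # w # x # v # p)" "l \<ge> 2"
  shows "distinct [c {u, w}, c {w, x}, c {x, v}]"
  using distance_proper_nth_neq[OF assms(1), of 0 1] distance_proper_nth_neq[OF assms(1), of 0 2]
    distance_proper_nth_neq[OF assms(1), of 1 2] assms(2) by (simp add: numeral_2_eq_2)

lemma path_between_edge:
  assumes "{u, v} \<in> edges G" "u \<in> verts G" "v \<in> verts G" "u \<noteq> v"
  shows "\<exists>p. path_between G u p v \<and> distance_proper l c p"
  using assms distance_proper_edge
  by (intro exI[of _ "[u, v]"]) (simp add: path_between_def)

lemma path_between_two_edges:
  assumes "{u, w} \<in> edges G" "{w, v} \<in> edges G" "{u, w, v} \<subseteq> verts G" "distinct [u, w, v]"
    and "c {u, w} \<noteq> c {w, v}"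
  shows "\<exists>p. path_between G u p v \<and> distance_proper l c p"
  using assms distance_proper_two_edges[of c u w v l]
  by (intro exI[of _ "[u, w, v]"]) (simp add: path_between_def)

lemma path_between_three_edges:
  assumes "{u, w} \<in> edges G" "{w, x} \<in> edges G" "{x, v} \<in> edges G" "{u, w, x, v} \<subseteq> verts G"
    and "distinct [u, w, x, v]" "distinct [c {u, w}, c {w, x}, c {x, v}]"
  shows "\<exists>p. path_between G u p v \<and> distance_proper l c p"
  using assms distance_proper_three_edges[of c u w x v l]
  by (intro exI[of _ "[u, w, x, v]"]) (simp add: path_between_def)

lemma card_le_2_subset:
  assumes "finite S" "card S \<le> 2"
  shows "\<exists>a b. S \<subseteq> {a, b}"
proof -
  consider "card S = 0" | "card S = 1" | "card S = 2"
    using assms(2) by linarith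
  then show ?thesis
    using assms(1) by cases (auto simp: card_1_singleton_iff card_2_iff)
qed

text \<open>Nonadjacency forces at least two edges, and a third would need a third color. Since
  \<open>a = b\<close> is allowed, the one-color case is covered too.\<close>

lemma two_colors_short_path:
  assumes "proper_connected l G c" "l \<ge> 2" "c ` edges G \<subseteq> {a, b}"
    and "u \<in> verts G" "v \<in> verts G" "u \<noteq> v" "{u, v} \<notin> edges G"
  obtains w where "{u, w} \<in> edges G" "{w, v} \<in> edges G" "c {u, w} \<noteq> c {w, v}"
proof -
  obtain p where p: "path_between G u p v" "distance_proper l c p"
    using assms unfolding proper_connected_def by blast
  then obtain w x q where q: "p = u # w # x # q"
    using assms(6,7) unfolding path_between_def
    by (cases p; cases "tl p"; cases "tl (tl p)") auto
  have edges: "{u, w} \<in> edges G" "{w, x} \<in> edges G"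
    using p(1) unfolding path_between_def q by auto
  have "q = []"
  proof (rule ccontr)
    assume "q \<noteq> []"
    then obtain y r where r: "q = y # r"
      by (cases q) auto
    have "{x, y} \<in> edges G"
      using p(1) unfolding path_between_def q r by auto
    with edges have "c {u, w} \<in> {a, b}" "c {w, x} \<in> {a, b}" "c {x, y} \<in> {a, b}"
      using assms(3) by blast+
    with distance_proper_first_three[of l c u w x y r] p(2) assms(2) show False
      unfolding q r by auto
  qed
  then have "x = v"
    using p(1) unfolding path_between_def q by auto
  with that edges distance_proper_first_two[of l c u w x q] p(2) assms(2) show thesis
    unfolding q by auto
qed

text \<open>The lower bound, applied to \<open>c\<close> itself, shows that all \<open>k\<close>
  colors occur, so surjectivity onto \<open>{..<k}\<close> need not be checked for a concrete
  coloring.\<close>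

lemma pc1_eqI:
  assumes "proper_connected l G c" "c ` edges G \<subseteq> {..<k}"
    and least: "\<And>c. \<lbrakk>proper_connected l G c; finite (c ` edges G)\<rbrakk> \<Longrightarrow> k \<le> card (c ` edges G)"
  shows "pc1 l G = k"
proof -
  have fin: "finite (c ` edges G)"
    using assms(2) finite_subset by blast
  moreover have "card (c ` edges G) = k"
    using card_mono[OF _ assms(2)] least[OF assms(1) fin] by simp
  ultimately show ?thesis
    unfolding pc1_def using assms(1) least by (intro Least_equality) blast+
qed

section \<open>The wheel\<close>

lemma verts_wheel: "verts (wheel n) = insert None (Some ` {..<n})"
  by (simp add: wheel_def join_vertex_def cycle_graph_def)

lemma spoke_iff: "{None, Some i} \<in> edges (wheel n) \<longleftrightarrow> i < n"
  "{Some i, None} \<in> edges (wheel n) \<longleftrightarrow> i < n"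
  by (auto simp: wheel_def join_vertex_def cycle_graph_def doubleton_eq_iff)

lemma rim_iff:
  "{Some i, Some j} \<in> edges (wheel n) \<longleftrightarrow>
     i < n \<and> j < n \<and> (j = Suc i mod n \<or> i = Suc j mod n)"
proof
  assume "{Some i, Some j} \<in> edges (wheel n)"
  then obtain k where "k < n" "{Some i, Some j} = {Some k, Some (Suc k mod n)}"
    by (auto simp: wheel_def join_vertex_def cycle_graph_def doubleton_eq_iff)
  then show "i < n \<and> j < n \<and> (j = Suc i mod n \<or> i = Suc j mod n)"
    by (auto simp: doubleton_eq_iff)
next
  assume *: "i < n \<and> j < n \<and> (j = Suc i mod n \<or> i = Suc j mod n)"
  have "{Some k, Some (Suc k mod n)} \<in> edges (wheel n)" if "k < n" for k
  proof -
    have "{k, Suc k mod n} \<in> edges (cycle_graph n)"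
      using that by (auto simp: cycle_graph_def)
    from imageI[OF this, of "(`) Some"] show ?thesis
      by (simp add: wheel_def join_vertex_def)
  qed
  with * show "{Some i, Some j} \<in> edges (wheel n)"
    by (metis insert_commute)
qed

lemma rim_iff_Suc:
  "{Some i, Some j} \<in> edges (wheel n) \<longleftrightarrow>
     i < n \<and> j < n \<and> (j = Suc i \<or> i = Suc j \<or> (Suc i = n \<and> j = 0) \<or> (Suc j = n \<and> i = 0))"
  by (auto simp: rim_iff mod_Suc)

text \<open>Adjacent vertices are joined by their edge and the hub is adjacent to every rim vertex,
  so only nonadjacent rim pairs remain.\<close>

lemma proper_connected_wheelI:
  assumes "\<And>i j. \<lbrakk>i < n; j < n; i \<noteq> j; {Some i, Some j} \<notin> edges (wheel n)\<rbrakk> \<Longrightarrow>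
    \<exists>p. path_between (wheel n) (Some i) p (Some j) \<and> distance_proper l c p"
  shows "proper_connected l (wheel n) c"
  unfolding proper_connected_def
proof (intro ballI impI)
  fix u v assume uv: "u \<in> verts (wheel n)" "v \<in> verts (wheel n)" "u \<noteq> v"
  show "\<exists>p. path_between (wheel n) u p v \<and> distance_proper l c p"
  proof (cases "{u, v} \<in> edges (wheel n)")
    case True
    with uv show ?thesis by (intro path_between_edge)
  next
    case False
    with uv assms show ?thesis
      by (auto simp: verts_wheel spoke_iff)
  qed
qed

section \<open>Upper bounds: explicit colorings\<close>

lemma one_color_wheel_3: "proper_connected l (wheel 3) (\<lambda>_. 0)"
  \<comment> \<open>\<open>wheel 3\<close> is a complete graph, so no nonadjacent pair is
    left.\<close>
  by (rule proper_connected_wheelI) (auto simp: rim_iff_Suc)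

lemma two_colors_wheel_4_5_6:
  assumes "4 \<le> n" "n \<le> 6"
  shows "\<exists>c. proper_connected l (wheel n) c \<and> c ` edges (wheel n) \<subseteq> {..<2}"
proof -
  \<comment> \<open>The rim splits into the blocks 0, 1, 2 and 3, ..., \<open>n - 1\<close>, of at
    most three vertices each. Spokes are colored by block, which joins different blocks through the
    hub; the rim colors make the two edges inside a full block differ.\<close>
  define c :: "nat option set \<Rightarrow> nat" where
    "c e = (if None \<in> e then if e \<subseteq> {None, Some 0, Some 1, Some 2} then 0 else 1
            else if e = {Some 1, Some 2} \<or> e = {Some 4, Some 5} then 1 else 0)" for e
  have "proper_connected l (wheel n) c"
  proof (rule proper_connected_wheelI)
    fix i j assume ij: "i < n" "j < n" "i \<noteq> j" "{Some i, Some j} \<notin> edges (wheel n)"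
    let ?G = "wheel n"
    show "\<exists>p. path_between ?G (Some i) p (Some j) \<and> distance_proper l c p"
    proof (cases "(i < 3) = (j < 3)")
      case False
      with ij show ?thesis
        by (intro path_between_two_edges[of _ None]) (auto simp: c_def verts_wheel spoke_iff)
    next
      case True
      have "j \<noteq> Suc i" "i \<noteq> Suc j"
        using ij by (auto simp: rim_iff_Suc)
      moreover have "i \<in> {0, 1, 2} \<and> j \<in> {0, 1, 2} \<or> i \<in> {3, 4, 5} \<and> j \<in> {3, 4, 5}"
        using True ij(1,2) assms(2) by (cases "i < 3") auto
      \<comment> \<open>Only the two ends of a block can be nonadjacent; they are joined through its
        middle vertex, 1 or 4.\<close>
      ultimately consider "i = 0" "j = 2" | "i = 2" "j = 0" | "i = 3" "j = 5" | "i = 5" "j = 3"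
        using ij(3) by auto
      then show ?thesis
      proof cases
        case 1
        with ij assms show ?thesis
          by (intro path_between_two_edges[of _ "Some 1"])
            (auto simp: c_def verts_wheel rim_iff_Suc doubleton_eq_iff)
      next
        case 2
        with ij assms show ?thesis
          by (intro path_between_two_edges[of _ "Some 1"])
            (auto simp: c_def verts_wheel rim_iff_Suc doubleton_eq_iff)
      next
        case 3
        with ij assms show ?thesis
          by (intro path_between_two_edges[of _ "Some 4"])
            (auto simp: c_def verts_wheel rim_iff_Suc doubleton_eq_iff)
      next
        case 4
        with ij assms show ?thesis
          by (intro path_between_two_edges[of _ "Some 4"])
            (auto simp: c_def verts_wheel rim_iff_Suc doubleton_eq_iff)
      qed
    qed
  qed
  moreover have "c ` edges (wheel n) \<subseteq> {..<2}"
    by (auto simp: c_def)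
  ultimately show ?thesis by blast
qed

lemma three_colors_wheel:
  assumes "n \<ge> 2"
  shows "\<exists>c. proper_connected l (wheel n) c \<and> c ` edges (wheel n) \<subseteq> {..<3}"
proof -
  define c :: "nat option set \<Rightarrow> nat" where
    "c e = (if None \<in> e then if \<exists>k. even k \<and> Some k \<in> e then 0 else 1 else 2)" for e
  have "proper_connected l (wheel n) c"
  proof (rule proper_connected_wheelI)
    fix i j assume ij: "i < n" "j < n" "i \<noteq> j" "{Some i, Some j} \<notin> edges (wheel n)"
    let ?G = "wheel n"
    show "\<exists>p. path_between ?G (Some i) p (Some j) \<and> distance_proper l c p"
    proof (cases "even i = even j")
      case False
      with ij show ?thesis
        by (intro path_between_two_edges[of _ None]) (auto simp: c_def verts_wheel spoke_iff)
    next
      case True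
      \<comment> \<open>The last vertex steps back instead of wrapping around: for odd
        \<open>n\<close>, both \<open>n - 1\<close> and 0 are even.\<close>
      define m where "m = (if Suc i < n then Suc i else i - 1)"
      have m: "m < n" "even m \<noteq> even i" "{Some i, Some m} \<in> edges ?G"
        using ij assms by (auto simp: m_def rim_iff_Suc)
      with True have "m \<noteq> i" "m \<noteq> j"
        by auto
      with True ij m show ?thesis
        by (intro path_between_three_edges[of _ "Some m" _ None])
          (auto simp: c_def verts_wheel spoke_iff)
    qed
  qed
  moreover have "c ` edges (wheel n) \<subseteq> {..<3}"
    by (auto simp: c_def)
  ultimately show ?thesis by blast
qed

section \<open>Lower bounds on the number of colors\<close>

lemma wheel_edge_color_pos:
  assumes "n \<ge> 1" "finite (c ` edges (wheel n))"
  shows "1 \<le> card (c ` edges (wheel n))"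
proof -
  have "edges (wheel n) \<noteq> {}"
    using assms(1) spoke_iff(1)[of 0 n] by auto
  then show ?thesis
    using assms(2) by (simp add: Suc_le_eq card_gt_0_iff)
qed

lemma wheel_two_colors_needed:
  assumes "proper_connected l (wheel n) c" "finite (c ` edges (wheel n))" "l \<ge> 2" "n \<ge> 4"
  shows "2 \<le> card (c ` edges (wheel n))"
proof (rule ccontr)
  assume "\<not> 2 \<le> card (c ` edges (wheel n))"
  with wheel_edge_color_pos[of n c] assms have "card (c ` edges (wheel n)) = 1"
    by simp
  then obtain a where a: "c ` edges (wheel n) = {a}"
    by (auto simp: card_1_singleton_iff)
  obtain w where "{Some 0, w} \<in> edges (wheel n)" "{w, Some 2} \<in> edges (wheel n)"
    "c {Some 0, w} \<noteq> c {w, Some 2}"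
    using two_colors_short_path[OF assms(1,3), of a a "Some 0" "Some 2"] a assms(4)
    by (auto simp: verts_wheel rim_iff_Suc)
  with a show False by (metis image_eqI singletonD)
qed

lemma wheel_three_colors_needed:
  assumes "proper_connected l (wheel n) c" "finite (c ` edges (wheel n))" "l \<ge> 2" "n \<ge> 7"
  shows "3 \<le> card (c ` edges (wheel n))"
proof (rule ccontr)
  assume "\<not> 3 \<le> card (c ` edges (wheel n))"
  then obtain a b where ab: "c ` edges (wheel n) \<subseteq> {a, b}"
    using card_le_2_subset[OF assms(2)] by auto
  define s where "s i = c {None, Some i}" for i
  have s: "s i \<in> {a, b}" if "i < n" for i
    using that ab spoke_iff(1)[of i n] unfolding s_def by blast
  \<comment> \<open>The two inequalities bound both arcs from \<open>i\<close> to \<open>j\<close>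
    below by 3, so no rim vertex is adjacent to both and the middle vertex must be the hub.\<close>
  have far: "s i \<noteq> s j" if "i + 3 \<le> j" "j + 3 \<le> i + n" "j < n" for i j
  proof -
    have "Some i \<in> verts (wheel n)" "Some j \<in> verts (wheel n)" "Some i \<noteq> Some j"
      "{Some i, Some j} \<notin> edges (wheel n)"
      using that by (auto simp: verts_wheel rim_iff_Suc)
    from two_colors_short_path[OF assms(1,3) ab this]
    obtain w where w: "{Some i, w} \<in> edges (wheel n)" "{w, Some j} \<in> edges (wheel n)"
      "c {Some i, w} \<noteq> c {w, Some j}"
      by blast
    have "w = None"
    proof (cases w)
      case (Some k)
      with w that show ?thesis by (auto simp: rim_iff_Suc)
    qed
    with w(3) show ?thesis
      by (simp add: s_def insert_commute)
  qed
  \<comment> \<open>With two colors, comparing with \<open>a\<close> turns \<open>far\<close> into a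
    propositional constraint, so an odd cycle is refuted by \<open>simp\<close>.\<close>
  have far_bool: "(s i = a) \<noteq> (s j = a)" if "i + 3 \<le> j" "j + 3 \<le> i + n" "j < n" for i j
    using far[OF that] s[of i] s[of j] that by auto
  consider "n = 7" | "n = 8" | "n \<ge> 9"
    using assms(4) by linarith
  then show False
  proof cases
    case 1
    then show False
      using far_bool[of 0 3] far_bool[of 3 6] far_bool[of 2 6] far_bool[of 2 5] far_bool[of 1 5]
        far_bool[of 1 4] far_bool[of 0 4] by simp
  next
    case 2
    then show False
      using far_bool[of 0 3] far_bool[of 3 6] far_bool[of 1 6] far_bool[of 1 4] far_bool[of 0 4]
      by simp
  next
    case 3
    then show False
      using far_bool[of 0 3] far_bool[of 3 6] far_bool[of 0 6] by simp
  qed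
qed

theorem theorem2p9:
  fixes n l :: nat
  assumes "n \<ge> 3" and "l \<ge> 2"
  shows "pc1 l (wheel n) = (if n = 3 then 1 else if 4 \<le> n \<and> n \<le> 6 then 2 else 3)"
proof -
  consider "n = 3" | "4 \<le> n" "n \<le> 6" | "n \<ge> 7"
    using assms(1) by linarith
  then show ?thesis
  proof cases
    case 1
    then have "pc1 l (wheel n) = 1"
      using one_color_wheel_3 wheel_edge_color_pos[of n]
      by (intro pc1_eqI[of _ _ "\<lambda>_. 0"]) auto
    with 1 show ?thesis by simp
  next
    case 2
    then obtain c where "proper_connected l (wheel n) c" "c ` edges (wheel n) \<subseteq> {..<2}"
      using two_colors_wheel_4_5_6 by blast
    then have "pc1 l (wheel n) = 2"
      by (rule pc1_eqI) (use wheel_two_colors_needed assms 2 in blast)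
    with 2 show ?thesis by simp
  next
    case 3
    then obtain c where "proper_connected l (wheel n) c" "c ` edges (wheel n) \<subseteq> {..<3}"
      using three_colors_wheel[of n l] by auto
    then have "pc1 l (wheel n) = 3"
      by (rule pc1_eqI) (use wheel_three_colors_needed assms 3 in blast)
    with 3 show ?thesis by simp
  qed
qed

end
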